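(* Let $\Gamma:\ell_\infty^+\to\ell_\infty^+$ be a (well-defined and continuous) sum-type gain operator satisfying the $\oplus$-MBI property with some $\varphi\in\mathcal{K}_\infty$. Assume that: (A) the family $\{\gamma_{ij}:i,j\in\mathbb{N}\}$ is pointwise equicontinuous; (B) there exists $\omega\in\mathcal{K}_\infty$ with $\omega<\mathrm{id}$ such that the system induced by $\Gamma_\omega=\omega^{-1}\circ\Gamma$ is UGAS; (C) for every compact interval $J\subset(0,\infty)$ there exists $c>0$ such that $|\gamma_{ij}(r_1)-\gamma_{ij}(r_2)|\ge c|r_1-r_2|$ for all $i\in\mathbb{N}$, $j\in I_i$ and $r_1,r_2\in J$. Additionally, let the following assumptions hold: (i) $\Gamma^2=\Gamma\circ\Gamma$ is an order contraction on each of the order intervals $[R_1\mathbb{1},R_2\mathbb{1}]$, $0<R_1<R_2$. That is, there exist constants $K=K(R_1,R_2)\in(0,1)$ such that $\|\Gamma^2(s^2)-\Gamma^2(s^1)\|_\infty\le K\|s^2-s^1\|_\infty$ whenever $R_1\mathbb{1}\le s^1\le s^2\le R_2\mathbb{1}$. (ii) The cardinality of $I_i$ is bounded over $i\in\mathbb{N}$, and for every compact interval $J\subset(0,\infty)$ there exists $C>0$ such that $|\gamma_{ij}(r_1)-\gamma_{ij}(r_2)|\le C|r_1-r_2|$ whenever $r_1,r_2\in J$ and $i\in\mathbb{N}$, $j\in I_i$. Then $\sigma(r):=\sigma_*(r)=\sigma^*(r)$ is a path of decay for $\Gamma$ (in particular $\sigma_*=\sigma^*$).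
   Context: $\mathbb{N}=\{1,2,\dots\}$, $\mathbb{Z}_+=\{0,1,\dots\}$, $\mathbb{R}_+=[0,\infty)$. $\ell_\infty$ is the Banach space of bounded real sequences with sup norm $\|\cdot\|_\infty$; $\ell_\infty^+$ is the cone of nonnegative sequences; $\le$ is the componentwise order; $\oplus$, $\bigoplus$ denote componentwise max/supremum; $\mathbb{1}$ is the sequence with all components $1$. Order interval: $[a,b]=\{s: a\le s\le b\}$. $\mathcal{K}$: continuous strictly increasing $\gamma:\mathbb{R}_+\to\mathbb{R}_+$ with $\gamma(0)=0$; $\mathcal{K}_\infty$: unbounded elements of $\mathcal{K}$; $\mathcal{KL}$: continuous $\beta:\mathbb{R}_+^2\to\mathbb{R}_+$ with $\beta(\cdot,t)\in\mathcal{K}$ for all $t\ge0$ and, for all $r>0$, $\beta(r,\cdot)$ strictly decreasing with limit $0$ at infinity. $\omega<\mathrm{id}$ means $\omega(r)<r$ for all $r>0$; scalar functions are applied componentwise. Sum-type gain operator: for each $i\in\mathbb{N}$ one is given a finite set $I_i\subset\mathbb{N}\setminus\{i\}$ and functions $\gamma_{ij}\in\mathcal{K}\cup\{0\}$ ($j\in\mathbb{N}$) with $\gamma_{ij}=0$ for $j\notin I_i$; $\Gamma(s)=(\sum_{j\in\mathbb{N}}\gamma_{ij}(s_j))_{i\in\mathbb{N}}$. "Well-defined and continuous" (standing assumption): $\Gamma$ maps $\ell_\infty^+$ into itself and is norm-continuous. $\oplus$-MBI property with $\varphi\in\mathcal{K}_\infty$: for all $s,b\in\ell_\infty^+$, $s\le\Gamma(s)\oplus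 b\Rightarrow\|s\|_\infty\le\varphi(\|b\|_\infty)$. The system $s(k+1)=T(s(k))$ induced by a monotone $T:\ell_\infty^+\to\ell_\infty^+$ is UGAS if there is $\beta\in\mathcal{KL}$ with $\|T^k(s)\|_\infty\le\beta(\|s\|_\infty,k)$ for all $s\in\ell_\infty^+$, $k\ge0$. Augmented gain operator: $\hat\Gamma(s)=s\oplus\Gamma(s)$. $\sigma_*(r):=\bigoplus_{k=0}^\infty\hat\Gamma^k(r\mathbb{1})$ for $r\ge0$. For $r\ge0$, $\Gamma_r(s):=r\mathbb{1}\oplus\Gamma(s)$, and $\sigma^*_i(r):=\inf_{n\in\mathbb{Z}_+}\pi_i(\Gamma_r^n(\varphi(r)\mathbb{1}))$, $\pi_i$ being the $i$th coordinate. A path of decay for $\Gamma$ is a mapping $\sigma:\mathbb{R}_+\to\ell_\infty^+$, with components $\sigma_i$, such that: (P1) $\Gamma(\sigma(r))\le\sigma(r)$ for all $r\ge0$; (P2) there are $\sigma_{\min},\sigma_{\max}\in\mathcal{K}_\infty$ with $\sigma_{\min}\le\sigma_i\le\sigma_{\max}$ for all $i$; (P3) each $\sigma_i\in\mathcal{K}_\infty$; (P4) for every compact interval $J\subset(0,\infty)$ there are $0<c\le C<\infty$ with $c|r_1-r_2|\le|\sigma_i^{-1}(r_1)-\sigma_i^{-1}(r_2)|\le C|r_1-r_2|$ for all $r_1,r_2\in J$, $i\in\mathbb{N}$. *)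

theory Defs
  imports "HOL-Analysis.Analysis"
begin

text \<open>
  Sequences are plain functions of type \<open>nat \<Rightarrow> real\<close>, so that \<open>\<le>\<close> and \<open>sup\<close> on them are the
  componentwise order and maximum.  The index set $\{1,2,\dots\}$ is relabelled as the type
  \<open>nat\<close>.  Functions on the half-line are total functions of which only the restriction to \<open>{0..}\<close>
  matters.
\<close>

definition linf :: "(nat \<Rightarrow> real) set" where
  "linf = {s. bounded (range s)}"

definition linf_plus :: "(nat \<Rightarrow> real) set" where
  "linf_plus = {s \<in> linf. \<forall>i. 0 \<le> s i}"

definition linf_norm :: "(nat \<Rightarrow> real) \<Rightarrow> real" where
  "linf_norm s = (SUP i. \<bar>s i\<bar>)"

definition norm_continuous :: "((nat \<Rightarrow> real) \<Rightarrow> nat \<Rightarrow> real) \<Rightarrow> bool" where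
  "norm_continuous T \<longleftrightarrow>
     (\<forall>s\<in>linf_plus. \<forall>\<epsilon>>0. \<exists>\<delta>>0. \<forall>t\<in>linf_plus.
        linf_norm (t - s) < \<delta> \<longrightarrow> linf_norm (T t - T s) < \<epsilon>)"

abbreviation const_seq :: "real \<Rightarrow> nat \<Rightarrow> real" where
  "const_seq r \<equiv> (\<lambda>i. r)"

text \<open>
  The next three lemmas identify the above with the library's Banach space \<open>nat \<Rightarrow>\<^sub>C real\<close>
  (on the discrete space \<open>nat\<close> every function is continuous).
\<close>

lemma linf_eq_bcontfun: "linf = bcontfun"
  by (auto simp: linf_def bcontfun_def)

lemma linf_norm_eq_norm:
  assumes "s \<in> linf"
  shows "linf_norm s = norm (Bcontfun s)"
  using assms
  by (simp add: linf_norm_def norm_bcontfun_def dist_bcontfun_def linf_eq_bcontfun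
      Bcontfun_inverse zero_bcontfun.rep_eq)

lemma norm_continuous_iff_continuous_on:
  assumes "T ` linf_plus \<subseteq> linf_plus"
  shows "norm_continuous T \<longleftrightarrow>
    continuous_on (Bcontfun ` linf_plus) (\<lambda>f. Bcontfun (T (apply_bcontfun f)))"
proof -
  have inv: "apply_bcontfun (Bcontfun s) = s" if "s \<in> linf_plus" for s
    using that by (simp add: linf_plus_def linf_eq_bcontfun Bcontfun_inverse)
  have d: "dist (Bcontfun t) (Bcontfun s) = linf_norm (t - s)"
    if "s \<in> linf_plus" "t \<in> linf_plus" for s t
    by (simp add: dist_bcontfun_def linf_norm_def inv that dist_real_def)
  have T: "T s \<in> linf_plus" if "s \<in> linf_plus" for s
    using assms that by blast
  show ?thesis
    by (simp add: norm_continuous_def continuous_on_iff inv d T)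
qed

definition class_K :: "(real \<Rightarrow> real) set" where
  "class_K = {\<gamma>. \<gamma> ` {0..} \<subseteq> {0..} \<and> continuous_on {0..} \<gamma> \<and> strict_mono_on {0..} \<gamma> \<and> \<gamma> 0 = 0}"

definition class_Kinf :: "(real \<Rightarrow> real) set" where
  "class_Kinf = {\<gamma> \<in> class_K. \<not> bdd_above (\<gamma> ` {0..})}"

definition class_KL :: "(real \<Rightarrow> real \<Rightarrow> real) set" where
  "class_KL = {\<beta>. continuous_on ({0..} \<times> {0..}) (\<lambda>(r, t). \<beta> r t) \<and>
     (\<forall>t\<ge>0. (\<lambda>r. \<beta> r t) \<in> class_K) \<and>
     (\<forall>r>0. strict_antimono_on {0..} (\<beta> r) \<and> (\<beta> r \<longlongrightarrow> 0) at_top)}"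

definition inv_pos :: "(real \<Rightarrow> real) \<Rightarrow> real \<Rightarrow> real" where
  "inv_pos f = inv_into {0..} f"

definition gain_family :: "(nat \<Rightarrow> nat set) \<Rightarrow> (nat \<Rightarrow> nat \<Rightarrow> real \<Rightarrow> real) \<Rightarrow> bool" where
  "gain_family I \<gamma> \<longleftrightarrow>
     (\<forall>i. finite (I i) \<and> i \<notin> I i) \<and>
     (\<forall>i j. \<gamma> i j \<in> class_K \<or> (\<forall>r\<ge>0. \<gamma> i j r = 0)) \<and>
     (\<forall>i j. j \<notin> I i \<longrightarrow> (\<forall>r\<ge>0. \<gamma> i j r = 0))"

definition sum_gain :: "(nat \<Rightarrow> nat \<Rightarrow> real \<Rightarrow> real) \<Rightarrow> (nat \<Rightarrow> real) \<Rightarrow> nat \<Rightarrow> real" where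
  "sum_gain \<gamma> s = (\<lambda>i. \<Sum>j. \<gamma> i j (s j))"

definition pointwise_equicontinuous :: "(nat \<Rightarrow> nat \<Rightarrow> real \<Rightarrow> real) \<Rightarrow> bool" where
  "pointwise_equicontinuous \<gamma> \<longleftrightarrow>
     (\<forall>r\<ge>0. \<forall>\<epsilon>>0. \<exists>\<delta>>0. \<forall>i j. \<forall>r'\<ge>0. \<bar>r' - r\<bar> < \<delta> \<longrightarrow> \<bar>\<gamma> i j r' - \<gamma> i j r\<bar> < \<epsilon>)"

definition oplus_MBI :: "((nat \<Rightarrow> real) \<Rightarrow> nat \<Rightarrow> real) \<Rightarrow> (real \<Rightarrow> real) \<Rightarrow> bool" where
  "oplus_MBI \<Gamma> \<phi> \<longleftrightarrow>
     (\<forall>s\<in>linf_plus. \<forall>b\<in>linf_plus. s \<le> sup (\<Gamma> s) b \<longrightarrow> linf_norm s \<le> \<phi> (linf_norm b))"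

definition UGAS :: "((nat \<Rightarrow> real) \<Rightarrow> nat \<Rightarrow> real) \<Rightarrow> bool" where
  "UGAS T \<longleftrightarrow>
     (\<exists>\<beta>\<in>class_KL. \<forall>s\<in>linf_plus. \<forall>k::nat. linf_norm ((T ^^ k) s) \<le> \<beta> (linf_norm s) (real k))"

definition augmented :: "((nat \<Rightarrow> real) \<Rightarrow> nat \<Rightarrow> real) \<Rightarrow> (nat \<Rightarrow> real) \<Rightarrow> nat \<Rightarrow> real" where
  "augmented \<Gamma> s = sup s (\<Gamma> s)"

text \<open>
  The pointwise suprema below are suprema of reals, hence meaningful only if the iterates are
  bounded above componentwise.
\<close>

definition sigma_sub :: "((nat \<Rightarrow> real) \<Rightarrow> nat \<Rightarrow> real) \<Rightarrow> real \<Rightarrow> nat \<Rightarrow> real" where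
  "sigma_sub \<Gamma> r = (\<lambda>i. SUP k::nat. (augmented \<Gamma> ^^ k) (const_seq r) i)"

definition Gamma_r :: "((nat \<Rightarrow> real) \<Rightarrow> nat \<Rightarrow> real) \<Rightarrow> real \<Rightarrow> (nat \<Rightarrow> real) \<Rightarrow> nat \<Rightarrow> real" where
  "Gamma_r \<Gamma> r s = sup (const_seq r) (\<Gamma> s)"

definition sigma_sup ::
  "((nat \<Rightarrow> real) \<Rightarrow> nat \<Rightarrow> real) \<Rightarrow> (real \<Rightarrow> real) \<Rightarrow> real \<Rightarrow> nat \<Rightarrow> real" where
  "sigma_sup \<Gamma> \<phi> r = (\<lambda>i. INF n::nat. (Gamma_r \<Gamma> r ^^ n) (const_seq (\<phi> r)) i)"

definition path_of_decay ::
  "((nat \<Rightarrow> real) \<Rightarrow> nat \<Rightarrow> real) \<Rightarrow> (real \<Rightarrow> nat \<Rightarrow> real) \<Rightarrow> bool" where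
  "path_of_decay \<Gamma> \<sigma> \<longleftrightarrow>
     (\<forall>r\<ge>0. \<sigma> r \<in> linf_plus) \<and>
     (\<forall>r\<ge>0. \<Gamma> (\<sigma> r) \<le> \<sigma> r) \<and>
     (\<exists>\<sigma>min\<in>class_Kinf. \<exists>\<sigma>max\<in>class_Kinf. \<forall>i. \<forall>r\<ge>0. \<sigma>min r \<le> \<sigma> r i \<and> \<sigma> r i \<le> \<sigma>max r) \<and>
     (\<forall>i. (\<lambda>r. \<sigma> r i) \<in> class_Kinf) \<and>
     (\<forall>a b. 0 < a \<and> a \<le> b \<longrightarrow>
        (\<exists>c C. 0 < c \<and> c \<le> C \<and>
          (\<forall>i. \<forall>r\<^sub>1\<in>{a..b}. \<forall>r\<^sub>2\<in>{a..b}.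
             c * \<bar>r\<^sub>1 - r\<^sub>2\<bar> \<le> \<bar>inv_pos (\<lambda>r. \<sigma> r i) r\<^sub>1 - inv_pos (\<lambda>r. \<sigma> r i) r\<^sub>2\<bar> \<and>
             \<bar>inv_pos (\<lambda>r. \<sigma> r i) r\<^sub>1 - inv_pos (\<lambda>r. \<sigma> r i) r\<^sub>2\<bar> \<le> C * \<bar>r\<^sub>1 - r\<^sub>2\<bar>)))"

end

theory Submission
  imports Defs
begin

text \<open>
  Both limits are identified with the fixed points of \<open>Gamma_r \<Gamma> r\<close>.  The iterates from below
  coincide with those of the augmented operator and increase to a fixed point, which the MBI
  property bounds by \<open>\<phi> r\<close>.  Truncation from below by \<open>r\<close> shrinks increments of the gains, so
  \<open>(Gamma_r \<Gamma> r)\<^sup>2\<close> inherits the order contraction of \<open>\<Gamma>\<^sup>2\<close>; hence the even iterates from above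
  converge to the same fixed point, and perturbing \<open>r\<close> gives the Lipschitz bound for \<open>\<sigma>\<close>.

  For the lower bound, an increment of \<open>\<sigma>\<^sub>i\<close> is at least \<open>c\<close> times the increment of \<open>\<sigma>\<^sub>j\<close> for any
  \<open>j \<in> I i\<close>, unless \<open>\<sigma>\<^sub>i(r) = r\<close>.  If no path of length \<open>n\<close> starting from \<open>i\<close> meets an
  index with \<open>\<sigma>\<^sub>j(r) = r\<close>, then \<open>\<sigma>\<^sub>i(r) = (\<Gamma>\<^sup>n \<sigma>(r))\<^sub>i\<close>, which by UGAS is below \<open>r\<close> for large \<open>n\<close>.
\<close>

section \<open>Bounded sequences, comparison functions and their inverses\<close>

lemma linf_plusI: "(\<And>i. 0 \<le> s i) \<Longrightarrow> (\<And>i. s i \<le> M) \<Longrightarrow> s \<in> linf_plus"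
  unfolding linf_plus_def linf_def bounded_iff by auto

lemma linf_plus_nonneg: "s \<in> linf_plus \<Longrightarrow> 0 \<le> s i"
  by (simp add: linf_plus_def)

lemma linf_diff: "s \<in> linf \<Longrightarrow> t \<in> linf \<Longrightarrow> s - t \<in> linf"
  by (auto simp: linf_def fun_diff_def intro: bounded_minus_comp)

lemma abs_le_linf_norm: "s \<in> linf \<Longrightarrow> \<bar>s i\<bar> \<le> linf_norm s"
  unfolding linf_def linf_norm_def bounded_iff
  by (intro cSUP_upper) (auto simp: bdd_above_def)

lemma linf_norm_le: "(\<And>i. \<bar>s i\<bar> \<le> M) \<Longrightarrow> linf_norm s \<le> M"
  unfolding linf_norm_def by (rule cSUP_least) auto

lemma linf_norm_const [simp]: "linf_norm (const_seq r) = \<bar>r\<bar>"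
  by (simp add: linf_norm_def)

lemma class_K_mono: "f \<in> class_K \<Longrightarrow> 0 \<le> x \<Longrightarrow> x \<le> y \<Longrightarrow> f x \<le> f y"
  by (cases "x = y") (auto simp: class_K_def strict_mono_on_def less_le)

lemma class_K_le_iff:
  assumes "f \<in> class_K" "0 \<le> x" "0 \<le> y"
  shows "f x \<le> f y \<longleftrightarrow> x \<le> y"
  using assms unfolding class_K_def by (auto simp: strict_mono_on_less_eq)

lemma class_K_nonneg: "f \<in> class_K \<Longrightarrow> 0 \<le> x \<Longrightarrow> 0 \<le> f x"
  unfolding class_K_def by auto

lemma class_Kinf_surj:
  assumes "f \<in> class_Kinf" "0 \<le> y"
  shows "\<exists>x\<ge>0. f x = y"
proof -
  have f: "f \<in> class_K" and unb: "\<not> bdd_above (f ` {0..})"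
    using assms by (auto simp: class_Kinf_def)
  obtain z where z: "0 \<le> z" "y \<le> f z"
    using unb by (auto simp: bdd_above_def not_le intro: less_imp_le)
  have "continuous_on {0..z} f"
    using f by (auto simp: class_K_def intro: continuous_on_subset)
  then show ?thesis
    using IVT'[of f 0 y z] f z assms by (auto simp: class_K_def)
qed

lemma
  assumes "f \<in> class_Kinf" "0 \<le> y"
  shows inv_pos_nonneg: "0 \<le> inv_pos f y"
    and inv_pos_right: "f (inv_pos f y) = y"
proof -
  have "y \<in> f ` {0..}" using class_Kinf_surj[OF assms] by force
  then show "0 \<le> inv_pos f y" "f (inv_pos f y) = y"
    unfolding inv_pos_def using inv_into_into[of y f "{0..}"] by (auto simp: f_inv_into_f)
qed

lemma inv_pos_mono:
  assumes "f \<in> class_Kinf" "0 \<le> x" "x \<le> y"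
  shows "inv_pos f x \<le> inv_pos f y"
  using assms class_K_le_iff[of f "inv_pos f x" "inv_pos f y"]
  by (auto simp: class_Kinf_def inv_pos_nonneg inv_pos_right)

text \<open>The increment bounds are read at the preimages of \<open>u\<close> and \<open>v\<close>,
  so the constants turn into their reciprocals and exchange roles.\<close>

lemma inv_pos_bilipschitz:
  assumes f: "f \<in> class_Kinf" and m: "0 < m" "m \<le> M"
    and incr: "\<And>x y. \<alpha> \<le> x \<Longrightarrow> x \<le> y \<Longrightarrow> y \<le> \<beta> \<Longrightarrow>
      m * (y - x) \<le> f y - f x \<and> f y - f x \<le> M * (y - x)"
    and u: "0 \<le> u" "inv_pos f u \<in> {\<alpha>..\<beta>}" and v: "0 \<le> v" "inv_pos f v \<in> {\<alpha>..\<beta>}"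
  shows "1 / M * \<bar>u - v\<bar> \<le> \<bar>inv_pos f u - inv_pos f v\<bar>"
    and "\<bar>inv_pos f u - inv_pos f v\<bar> \<le> 1 / m * \<bar>u - v\<bar>"
proof -
  have M: "0 < M" using m by simp
  have *: "1 / M * \<bar>u - v\<bar> \<le> \<bar>inv_pos f u - inv_pos f v\<bar> \<and>
        \<bar>inv_pos f u - inv_pos f v\<bar> \<le> 1 / m * \<bar>u - v\<bar>"
    if "u \<le> v" "0 \<le> u" "0 \<le> v" "inv_pos f u \<in> {\<alpha>..\<beta>}" "inv_pos f v \<in> {\<alpha>..\<beta>}" for u v
  proof -
    have le: "inv_pos f u \<le> inv_pos f v" using inv_pos_mono[OF f] that by simp
    have "m * (inv_pos f v - inv_pos f u) \<le> v - u \<and> v - u \<le> M * (inv_pos f v - inv_pos f u)"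
      using incr[OF _ le] that by (simp add: inv_pos_right[OF f])
    then show ?thesis using le that(1) m(1) M by (simp add: field_simps)
  qed
  have "1 / M * \<bar>u - v\<bar> \<le> \<bar>inv_pos f u - inv_pos f v\<bar> \<and>
        \<bar>inv_pos f u - inv_pos f v\<bar> \<le> 1 / m * \<bar>u - v\<bar>"
    using *[of u v] *[of v u] u v by (cases "u \<le> v") (auto simp: abs_minus_commute)
  then show "1 / M * \<bar>u - v\<bar> \<le> \<bar>inv_pos f u - inv_pos f v\<bar>"
    and "\<bar>inv_pos f u - inv_pos f v\<bar> \<le> 1 / m * \<bar>u - v\<bar>" by auto
qed

section \<open>Monotonicity of the gain operator\<close>

locale gain_operator =
  fixes I :: "nat \<Rightarrow> nat set"
    and \<gamma> :: "nat \<Rightarrow> nat \<Rightarrow> real \<Rightarrow> real"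
    and \<phi> :: "real \<Rightarrow> real"
  assumes gains: "gain_family I \<gamma>"
    and well_defined: "sum_gain \<gamma> ` linf_plus \<subseteq> linf_plus"
    and phi: "\<phi> \<in> class_Kinf"
    and MBI: "oplus_MBI (sum_gain \<gamma>) \<phi>"
begin

abbreviation "\<Gamma> \<equiv> sum_gain \<gamma>"
abbreviation "\<sigma> \<equiv> sigma_sub \<Gamma>"

lemma phi_K: "\<phi> \<in> class_K"
  using phi by (simp add: class_Kinf_def)

lemma gain_nonneg: "0 \<le> x \<Longrightarrow> 0 \<le> \<gamma> i j x"
  using gains unfolding gain_family_def by (metis class_K_nonneg order.refl)

lemma gain_mono: "0 \<le> x \<Longrightarrow> x \<le> y \<Longrightarrow> \<gamma> i j x \<le> \<gamma> i j y"
  using gains unfolding gain_family_def by (metis class_K_mono order.refl order.trans)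

lemma gain_continuous: "continuous_on {0..} (\<gamma> i j)"
proof (cases "\<gamma> i j \<in> class_K")
  case False
  then have "\<And>r. r \<in> {0..} \<Longrightarrow> \<gamma> i j r = 0" using gains by (auto simp: gain_family_def)
  then show ?thesis by (subst continuous_on_cong[OF refl, where g = "\<lambda>_. 0"]) auto
qed (simp add: class_K_def)

lemma finite_I [simp]: "finite (I i)"
  using gains by (simp add: gain_family_def)

text \<open>Outside \<open>I i\<close> the gains vanish, though only on the half-line, which is why
  \<open>s\<close> is taken nonnegative. Every later argument uses this finite sum instead of the
  series.\<close>

lemma Gamma_eq:
  assumes "\<And>j. 0 \<le> s j"
  shows "\<Gamma> s i = (\<Sum>j\<in>I i. \<gamma> i j (s j))"
  unfolding sum_gain_def using gains assms by (intro suminf_finite) (auto simp: gain_family_def)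

lemma Gamma_nonneg: "(\<And>j. 0 \<le> s j) \<Longrightarrow> 0 \<le> \<Gamma> s i"
  by (simp add: Gamma_eq sum_nonneg gain_nonneg)

lemma Gamma_mono_on_I:
  assumes "\<And>j. 0 \<le> s j" "\<And>j. 0 \<le> t j" "\<And>j. j \<in> I i \<Longrightarrow> s j \<le> t j"
  shows "\<Gamma> s i \<le> \<Gamma> t i"
  using assms by (simp add: Gamma_eq sum_mono gain_mono)

lemma Gamma_mono:
  assumes "\<And>j. 0 \<le> s j" "\<And>j. s j \<le> t j"
  shows "\<Gamma> s i \<le> \<Gamma> t i"
  using assms by (intro Gamma_mono_on_I) (auto intro: order.trans)

lemma Gamma_linf_plus: "s \<in> linf_plus \<Longrightarrow> \<Gamma> s \<in> linf_plus"
  using well_defined by blast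

lemma Gamma_pow_nonneg: "(\<And>j. 0 \<le> s j) \<Longrightarrow> 0 \<le> (\<Gamma> ^^ n) s i"
  by (induction n arbitrary: i) (auto intro: Gamma_nonneg)

lemma Gamma_pow_mono:
  assumes "\<And>j. 0 \<le> s j" "\<And>j. s j \<le> t j"
  shows "(\<Gamma> ^^ n) s i \<le> (\<Gamma> ^^ n) t i"
  using assms by (induction n arbitrary: i) (auto intro!: Gamma_mono Gamma_pow_nonneg)

lemma Gamma_zero: "\<Gamma> (const_seq 0) = const_seq 0"
  using gains by (force simp: Gamma_eq gain_family_def class_K_def intro: sum.neutral)

section \<open>Iterates of the truncated operator from below\<close>

lemma Gamma_r_apply: "Gamma_r \<Gamma> r s i = max r (\<Gamma> s i)"
  by (simp add: Gamma_r_def sup_real_def)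

lemma Gamma_r_mono:
  assumes "\<And>j. 0 \<le> s j" "\<And>j. s j \<le> t j"
  shows "Gamma_r \<Gamma> r s i \<le> Gamma_r \<Gamma> r t i"
  using Gamma_mono[of s t i] assms by (auto simp: Gamma_r_apply)

lemma Gamma_r_pow_ge: "r \<le> s i \<Longrightarrow> r \<le> (Gamma_r \<Gamma> r ^^ n) s i"
  by (cases n) (auto simp: Gamma_r_apply)

text \<open>The constant \<open>r\<close> lies below its own image because of the truncation, and
  monotonicity propagates this along the iteration.\<close>

lemma Gamma_r_pow_const_mono:
  assumes "0 \<le> r"
  shows "(Gamma_r \<Gamma> r ^^ n) (const_seq r) i \<le> (Gamma_r \<Gamma> r ^^ Suc n) (const_seq r) i"
proof (induction n arbitrary: i)
  case 0
  then show ?case by (simp add: Gamma_r_apply)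
next
  case (Suc n)
  have "0 \<le> (Gamma_r \<Gamma> r ^^ n) (const_seq r) j" for j
    using Gamma_r_pow_ge[of r "const_seq r"] assms order.trans by blast
  then show ?case using Suc by (auto intro: Gamma_r_mono)
qed

text \<open>The iterate \<open>b\<close> satisfies both \<open>r \<le> b\<close> and
  \<open>b \<le> max r (\<Gamma> b)\<close>. Hence the maximum of \<open>\<Gamma> b\<close> with
  \<open>b\<close> is the same as its maximum with \<open>r\<close>.\<close>

lemma augmented_pow_eq:
  assumes "0 \<le> r"
  shows "(augmented \<Gamma> ^^ n) (const_seq r) = (Gamma_r \<Gamma> r ^^ n) (const_seq r)"
proof (induction n)
  case (Suc n)
  let ?b = "\<lambda>k. (Gamma_r \<Gamma> r ^^ k) (const_seq r)"
  have "sup (?b n) (\<Gamma> (?b n)) = Gamma_r \<Gamma> r (?b n)"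
  proof
    fix i
    have "?b n i \<le> max r (\<Gamma> (?b n) i)"
      using Gamma_r_pow_const_mono[OF assms, of n i] by (simp add: Gamma_r_apply)
    moreover have "r \<le> ?b n i" by (simp add: Gamma_r_pow_ge)
    ultimately show "sup (?b n) (\<Gamma> (?b n)) i = Gamma_r \<Gamma> r (?b n) i"
      by (auto simp: Gamma_r_apply sup_real_def)
  qed
  then show ?case using Suc by (simp add: augmented_def[of \<Gamma> "?b n"])
qed simp

lemma Gamma_r_linf_plus:
  assumes "0 \<le> r" "s \<in> linf_plus"
  shows "Gamma_r \<Gamma> r s \<in> linf_plus"
proof (rule linf_plusI)
  have "\<Gamma> s \<in> linf" using Gamma_linf_plus[OF assms(2)] by (simp add: linf_plus_def)
  then show "Gamma_r \<Gamma> r s i \<le> max r (linf_norm (\<Gamma> s))" for i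
    using abs_le_linf_norm[of "\<Gamma> s" i] by (auto simp: Gamma_r_apply)
qed (use assms in \<open>simp add: Gamma_r_apply le_max_iff_disj\<close>)

lemma Gamma_r_pow_linf_plus:
  "0 \<le> r \<Longrightarrow> s \<in> linf_plus \<Longrightarrow> (Gamma_r \<Gamma> r ^^ n) s \<in> linf_plus"
  by (induction n) (auto intro: Gamma_r_linf_plus)

lemma const_linf_plus: "0 \<le> r \<Longrightarrow> const_seq r \<in> linf_plus"
  by (rule linf_plusI[where M = r]) auto

text \<open>An iterate \<open>b\<close> lies below its successor, that is, below the maximum of
  \<open>\<Gamma> b\<close> and \<open>r\<close>, which is the premise of the MBI property.\<close>

lemma Gamma_r_pow_le_phi:
  assumes "0 \<le> r"
  shows "(Gamma_r \<Gamma> r ^^ n) (const_seq r) i \<le> \<phi> r"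
proof -
  let ?b = "(Gamma_r \<Gamma> r ^^ n) (const_seq r)"
  have b: "?b \<in> linf_plus" using assms by (simp add: Gamma_r_pow_linf_plus const_linf_plus)
  have "?b \<le> sup (\<Gamma> ?b) (const_seq r)"
    using Gamma_r_pow_const_mono[OF assms, of n]
    by (simp add: le_fun_def Gamma_r_def sup_commute)
  then have "linf_norm ?b \<le> \<phi> r"
    using MBI b const_linf_plus[OF assms] assms unfolding oplus_MBI_def by fastforce
  then show ?thesis using abs_le_linf_norm[of ?b i] b by (simp add: linf_plus_def)
qed

lemma augmented_bdd:
  "0 \<le> r \<Longrightarrow> bdd_above (range (\<lambda>k. (augmented \<Gamma> ^^ k) (const_seq r) i))"
  using Gamma_r_pow_le_phi by (auto simp: augmented_pow_eq intro!: bdd_aboveI[of _ "\<phi> r"])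

section \<open>The limit from below as least fixed point\<close>

lemma sigma_tendsto:
  assumes "0 \<le> r"
  shows "(\<lambda>n. (Gamma_r \<Gamma> r ^^ n) (const_seq r) i) \<longlonglongrightarrow> \<sigma> r i"
  using LIMSEQ_incseq_SUP[OF augmented_bdd[OF assms, of i]] Gamma_r_pow_const_mono[OF assms]
  by (simp add: sigma_sub_def augmented_pow_eq[OF assms] incseq_Suc_iff)

lemma sigma_ge: "0 \<le> r \<Longrightarrow> r \<le> \<sigma> r i"
  using LIMSEQ_le_const[OF sigma_tendsto] Gamma_r_pow_ge[of r "const_seq r"] by blast

lemma sigma_le: "0 \<le> r \<Longrightarrow> \<sigma> r i \<le> \<phi> r"
  using LIMSEQ_le_const2[OF sigma_tendsto] Gamma_r_pow_le_phi by blast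

text \<open>Squeezing \<open>\<sigma>\<close> shows that \<open>\<phi>\<close> dominates the
  identity; this later makes intervals such as \<open>{a..\<phi> b}\<close> nonempty.\<close>

lemma le_phi: "0 \<le> r \<Longrightarrow> r \<le> \<phi> r"
  using sigma_ge sigma_le order.trans by blast

lemma sigma_nonneg: "0 \<le> r \<Longrightarrow> 0 \<le> \<sigma> r i"
  using sigma_ge order.trans by blast

lemma sigma_linf_plus: "0 \<le> r \<Longrightarrow> \<sigma> r \<in> linf_plus"
  by (rule linf_plusI[where M = "\<phi> r"]) (auto simp: sigma_nonneg sigma_le)

text \<open>Each component of \<open>\<Gamma>\<close> is a finite sum of continuous gains, so
  componentwise convergence of the iterates suffices to pass to the limit.\<close>

lemma sigma_fixed:
  assumes "0 \<le> r"
  shows "Gamma_r \<Gamma> r (\<sigma> r) = \<sigma> r"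
proof
  fix i
  let ?b = "\<lambda>n. (Gamma_r \<Gamma> r ^^ n) (const_seq r)"
  have nn: "0 \<le> ?b n j" for n j using Gamma_r_pow_ge[of r "const_seq r"] assms order.trans by blast
  have "(\<lambda>n. \<gamma> i j (?b n j)) \<longlonglongrightarrow> \<gamma> i j (\<sigma> r j)" for j
    using continuous_on_tendsto_compose[OF gain_continuous sigma_tendsto[OF assms]]
    by (simp add: nn sigma_nonneg assms)
  then have "(\<lambda>n. \<Sum>j\<in>I i. \<gamma> i j (?b n j)) \<longlonglongrightarrow> (\<Sum>j\<in>I i. \<gamma> i j (\<sigma> r j))"
    by (rule tendsto_sum)
  then have "(\<lambda>n. \<Gamma> (?b n) i) \<longlonglongrightarrow> \<Gamma> (\<sigma> r) i"
    by (simp add: Gamma_eq nn sigma_nonneg assms)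
  then have "(\<lambda>n. ?b (Suc n) i) \<longlonglongrightarrow> max r (\<Gamma> (\<sigma> r) i)"
    by (simp add: Gamma_r_apply tendsto_max)
  then show "Gamma_r \<Gamma> r (\<sigma> r) i = \<sigma> r i"
    using LIMSEQ_Suc[OF sigma_tendsto[OF assms, of i]] LIMSEQ_unique
    by (fastforce simp: Gamma_r_apply)
qed

lemma sigma_eq: "0 \<le> r \<Longrightarrow> \<sigma> r i = max r (\<Gamma> (\<sigma> r) i)"
  using fun_cong[OF sigma_fixed, of r i] by (simp add: Gamma_r_apply)

lemma sigma_le_Gamma_r:
  assumes "0 \<le> r" "\<And>j. \<sigma> r j \<le> s j"
  shows "\<sigma> r i \<le> Gamma_r \<Gamma> r s i"
  using Gamma_r_mono[of "\<sigma> r" s r i] assms by (simp add: sigma_nonneg sigma_fixed)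

text \<open>By monotonicity, a supersolution above the starting point dominates every iterate, hence
  also their limit.\<close>

lemma sigma_least:
  assumes "0 \<le> r" and s: "\<And>i. r \<le> s i" "\<And>i. Gamma_r \<Gamma> r s i \<le> s i"
  shows "\<sigma> r i \<le> s i"
proof -
  have "(Gamma_r \<Gamma> r ^^ n) (const_seq r) i \<le> s i" for n i
  proof (induction n arbitrary: i)
    case (Suc n)
    have "0 \<le> (Gamma_r \<Gamma> r ^^ n) (const_seq r) j" for j
      using Gamma_r_pow_ge[of r "const_seq r"] assms(1) order.trans by blast
    then have "Gamma_r \<Gamma> r ((Gamma_r \<Gamma> r ^^ n) (const_seq r)) i \<le> Gamma_r \<Gamma> r s i"
      using Suc by (intro Gamma_r_mono) auto
    then show ?case using s(2)[of i] by simp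
  qed (simp add: s)
  then show ?thesis using LIMSEQ_le_const2[OF sigma_tendsto[OF assms(1)]] by blast
qed

lemma sigma_mono:
  assumes "0 \<le> r" "r \<le> r'"
  shows "\<sigma> r i \<le> \<sigma> r' i"
proof (rule sigma_least)
  show "r \<le> \<sigma> r' i" for i using sigma_ge[of r' i] assms by simp
  \<comment> \<open>A fixed point for the higher level \<open>r'\<close> is a supersolution for the
    lower level \<open>r\<close>.\<close>
  show "Gamma_r \<Gamma> r (\<sigma> r') i \<le> \<sigma> r' i" for i
    using assms sigma_eq[of r' i] by (simp add: Gamma_r_apply)
qed fact

lemma sigma_zero: "\<sigma> 0 i = 0"
  using sigma_le[of 0 i] sigma_nonneg[of 0 i] phi_K by (simp add: class_K_def)

section \<open>Effect of truncation, decay of iterates, and the lower increment bound\<close>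

lemma Gamma_max_diff_le:
  assumes "0 \<le> r" "\<And>j. 0 \<le> u j" "\<And>j. u j \<le> v j"
  shows "\<Gamma> (\<lambda>j. max r (v j)) i - \<Gamma> (\<lambda>j. max r (u j)) i \<le> \<Gamma> v i - \<Gamma> u i"
proof -
  \<comment> \<open>If \<open>r \<le> u j\<close> nothing changes; if \<open>r\<close> exceeds both
    arguments the left side is zero; if \<open>r\<close> lies between them, only the part of the
    increment above \<open>r\<close> remains.\<close>
  have "\<gamma> i j (max r (v j)) - \<gamma> i j (max r (u j)) \<le> \<gamma> i j (v j) - \<gamma> i j (u j)" for j
    using assms(1) assms(2,3)[of j] gain_mono[of "u j" "v j" i j] gain_mono[of "u j" r i j]
    by (cases "r \<le> u j"; cases "r \<le> v j") (auto simp: max_def not_le)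
  moreover have "0 \<le> v j" for j using assms(2,3) order.trans by blast
  ultimately show ?thesis
    using assms by (simp add: Gamma_eq le_max_iff_disj sum_subtractf[symmetric] sum_mono)
qed

text \<open>Since \<open>\<omega>\<close> lies below the identity, its inverse lies above it. The
  iterates of the inflated operator thus dominate those of \<open>\<Gamma>\<close>, and their decay
  in norm is uniform in \<open>i\<close>.\<close>

lemma Gamma_pow_const_small:
  assumes \<omega>: "\<omega> \<in> class_Kinf" "\<And>r. 0 < r \<Longrightarrow> \<omega> r < r"
    and UGAS: "UGAS (\<lambda>s i. inv_pos \<omega> (\<Gamma> s i))"
    and R: "0 < R" and \<epsilon>: "0 < \<epsilon>"
  shows "\<exists>n. \<forall>i. (\<Gamma> ^^ n) (const_seq R) i < \<epsilon>"
proof -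
  let ?T = "\<lambda>s i. inv_pos \<omega> (\<Gamma> s i)"
  have inv_ge: "y \<le> inv_pos \<omega> y" if "0 \<le> y" for y
  proof (cases "inv_pos \<omega> y = 0")
    case True
    then show ?thesis using inv_pos_right[OF \<omega>(1) that] \<omega>(1) by (simp add: class_Kinf_def class_K_def)
  next
    case False
    then have "0 < inv_pos \<omega> y" using inv_pos_nonneg[OF \<omega>(1) that] by simp
    then show ?thesis using \<omega>(2) inv_pos_right[OF \<omega>(1) that] by fastforce
  qed
  \<comment> \<open>Boundedness is needed because \<open>linf_norm\<close> is a real supremum, which
    bounds the components only of bounded sequences.\<close>
  have T: "?T s \<in> linf_plus" if "s \<in> linf_plus" for s
  proof (rule linf_plusI)
    fix i
    have nn: "0 \<le> \<Gamma> s i" using that by (simp add: Gamma_nonneg linf_plus_nonneg)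
    then show "0 \<le> ?T s i" by (rule inv_pos_nonneg[OF \<omega>(1)])
    have "\<Gamma> s i \<le> linf_norm (\<Gamma> s)"
      using abs_le_linf_norm[of "\<Gamma> s" i] Gamma_linf_plus[OF that] by (simp add: linf_plus_def)
    then show "?T s i \<le> inv_pos \<omega> (linf_norm (\<Gamma> s))" using nn by (intro inv_pos_mono[OF \<omega>(1)])
  qed
  have Tn: "(?T ^^ n) (const_seq R) \<in> linf_plus" for n
    using R by (induction n) (auto intro: T const_linf_plus)
  have dom: "(\<Gamma> ^^ n) (const_seq R) i \<le> (?T ^^ n) (const_seq R) i" for n i
  proof (induction n arbitrary: i)
    case (Suc n)
    have "\<Gamma> ((\<Gamma> ^^ n) (const_seq R)) i \<le> \<Gamma> ((?T ^^ n) (const_seq R)) i"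
      using Suc R by (intro Gamma_mono Gamma_pow_nonneg) auto
    also have "\<dots> \<le> ?T ((?T ^^ n) (const_seq R)) i"
      by (intro inv_ge Gamma_nonneg linf_plus_nonneg Tn)
    finally show ?case by simp
  qed simp
  obtain \<beta> where \<beta>: "\<beta> \<in> class_KL"
    and bound: "\<And>s k. s \<in> linf_plus \<Longrightarrow> linf_norm ((?T ^^ k) s) \<le> \<beta> (linf_norm s) (real k)"
    using UGAS unfolding UGAS_def by blast
  have "(\<beta> R \<longlongrightarrow> 0) at_top" using \<beta> R by (simp add: class_KL_def)
  then have "(\<lambda>n. \<beta> R (real n)) \<longlonglongrightarrow> 0"
    by (rule filterlim_compose[OF _ filterlim_real_sequentially])
  then have "eventually (\<lambda>n. \<beta> R (real n) < \<epsilon>) sequentially" using \<epsilon> by (rule order_tendstoD(2))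
  then obtain n where n: "\<beta> R (real n) < \<epsilon>" by (auto simp: eventually_sequentially)
  have "(\<Gamma> ^^ n) (const_seq R) i < \<epsilon>" for i
  proof -
    have "(?T ^^ n) (const_seq R) i \<le> linf_norm ((?T ^^ n) (const_seq R))"
      using abs_le_linf_norm[of "(?T ^^ n) (const_seq R)" i] Tn by (simp add: linf_plus_def)
    also have "\<dots> \<le> \<beta> R (real n)" using bound[of "const_seq R" n] R by (simp add: const_linf_plus)
    finally show ?thesis using dom[of n i] n by linarith
  qed
  then show ?thesis by blast
qed

text \<open>Each edge of a path costs one factor \<open>c\<close>, and \<open>c \<le> 1\<close> lets
  the single constant \<open>c ^ n\<close> serve shorter paths too. The gains are compared on
  \<open>{a..\<phi> b}\<close> because all values of \<open>\<sigma>\<close> at \<open>r\<close> and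
  \<open>r'\<close> lie there.\<close>

lemma sigma_increment_ge:
  assumes ab: "0 < a" "a \<le> b"
    and c: "0 < c" "c \<le> 1" "\<And>i j x y. j \<in> I i \<Longrightarrow> x \<in> {a..\<phi> b} \<Longrightarrow> y \<in> {a..\<phi> b} \<Longrightarrow>
      c * \<bar>x - y\<bar> \<le> \<bar>\<gamma> i j x - \<gamma> i j y\<bar>"
    and n: "\<And>i. (\<Gamma> ^^ n) (const_seq (\<phi> b)) i < a"
    and r: "a \<le> r" "r \<le> r'" "r' \<le> b"
  shows "c ^ n * (r' - r) \<le> \<sigma> r' i - \<sigma> r i"
proof -
  have r0: "0 \<le> r" "0 \<le> r'" "0 \<le> b" using r ab by auto
  have mono: "\<sigma> r j \<le> \<sigma> r' j" for j using sigma_mono r r0 by simp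
  have up: "\<sigma> r' j \<le> \<phi> b" for j
    using sigma_le[of r' j] class_K_mono[OF phi_K, of r' b] r r0 by simp
  have lo: "a \<le> \<sigma> r j" for j using sigma_ge[of r j] r r0 by simp
  have pow_nn: "0 \<le> (\<Gamma> ^^ m) (\<sigma> r) j" for m j using r0 by (intro Gamma_pow_nonneg sigma_nonneg)
  \<comment> \<open>The second alternative covers the indices from which no path of fewer than
    \<open>m\<close> edges reaches an active truncation; for \<open>m = 0\<close> it holds
    trivially.\<close>
  have "c ^ m * (r' - r) \<le> \<sigma> r' i - \<sigma> r i \<or> \<sigma> r i \<le> (\<Gamma> ^^ m) (\<sigma> r) i" for m i
  proof (induction m arbitrary: i)
    case (Suc m)
    consider (base) "\<sigma> r i = r"
      | (step) j where "\<sigma> r i = \<Gamma> (\<sigma> r) i" "j \<in> I i" "c ^ m * (r' - r) \<le> \<sigma> r' j - \<sigma> r j"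
      | (stop) "\<sigma> r i = \<Gamma> (\<sigma> r) i" "\<And>j. j \<in> I i \<Longrightarrow> \<sigma> r j \<le> (\<Gamma> ^^ m) (\<sigma> r) j"
      using Suc sigma_eq[OF r0(1), of i] by (metis max_def)
    then show ?case
    proof cases
      case base
      \<comment> \<open>With the truncation active at \<open>r\<close>, the increment is already at
        least \<open>r' - r\<close>, because \<open>\<sigma> r' i\<close> is at least
        \<open>r'\<close>.\<close>
      have "c ^ Suc m * (r' - r) \<le> r' - r"
        using c r by (intro mult_left_le_one_le) (auto intro!: power_le_one simp del: power_Suc)
      then show ?thesis using base sigma_ge[of r' i] r0 by simp
    next
      case step
      have "c ^ Suc m * (r' - r) \<le> c * (\<sigma> r' j - \<sigma> r j)"
        using step c(1) by (simp add: mult.assoc)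
      also have "\<dots> \<le> \<gamma> i j (\<sigma> r' j) - \<gamma> i j (\<sigma> r j)"
        using c(3)[OF step(2), of "\<sigma> r' j" "\<sigma> r j"] lo[of j] up[of j] mono[of j]
          gain_mono[of "\<sigma> r j" "\<sigma> r' j" i j] sigma_nonneg[OF r0(1)] by simp
      \<comment> \<open>The other neighbours contribute nonnegative increments.\<close>
      also have "\<dots> \<le> (\<Sum>k\<in>I i. \<gamma> i k (\<sigma> r' k) - \<gamma> i k (\<sigma> r k))"
        using step(2) mono r0 by (intro member_le_sum[of j]) (auto intro!: gain_mono sigma_nonneg)
      also have "\<dots> = \<Gamma> (\<sigma> r') i - \<Gamma> (\<sigma> r) i"
        using r0 by (simp add: Gamma_eq sigma_nonneg sum_subtractf)
      finally show ?thesis using step(1) sigma_eq[of r' i] r0 by linarith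
    next
      case stop
      then show ?thesis
        using Gamma_mono_on_I[of "\<sigma> r" "(\<Gamma> ^^ m) (\<sigma> r)" i] pow_nn r0 by (simp add: sigma_nonneg)
    qed
  qed simp
  \<comment> \<open>At \<open>m = n\<close> the second alternative fails: the iterate started from
    the larger constant \<open>\<phi> b\<close> is already below \<open>a\<close>, while
    \<open>\<sigma> r i\<close> is at least \<open>a\<close>.\<close>
  moreover have "(\<Gamma> ^^ n) (\<sigma> r) i < \<sigma> r i"
  proof -
    have "\<sigma> r j \<le> \<phi> b" for j using mono[of j] up[of j] by simp
    then have "(\<Gamma> ^^ n) (\<sigma> r) i \<le> (\<Gamma> ^^ n) (const_seq (\<phi> b)) i"
      using r0 by (intro Gamma_pow_mono sigma_nonneg) auto
    then show ?thesis using n[of i] lo[of i] by simp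
  qed
  ultimately show ?thesis by (metis not_le)
qed

section \<open>Reduction of the path properties to two-sided increment bounds\<close>

lemma path_of_decayI:
  assumes incr: "\<And>a b. 0 < a \<Longrightarrow> a \<le> b \<Longrightarrow> \<exists>m M. 0 < m \<and> 0 < M \<and>
    (\<forall>i r r'. a \<le> r \<longrightarrow> r \<le> r' \<longrightarrow> r' \<le> b \<longrightarrow>
      m * (r' - r) \<le> \<sigma> r' i - \<sigma> r i \<and> \<sigma> r' i - \<sigma> r i \<le> M * (r' - r))"
  shows "path_of_decay \<Gamma> \<sigma>"
proof -
  \<comment> \<open>The increment bounds hold only away from zero, so the left end
    \<open>r = 0\<close> is settled by \<open>\<sigma> r' i \<ge> r'\<close>.\<close>
  have strict: "\<sigma> r i < \<sigma> r' i" if "0 \<le> r" "r < r'" for r r' i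
  proof (cases "r = 0")
    case True
    then show ?thesis using sigma_zero sigma_ge[of r' i] that by simp
  next
    case False
    then have "0 < r" "r \<le> r'" using that by auto
    from incr[OF this] obtain m where "0 < m" "m * (r' - r) \<le> \<sigma> r' i - \<sigma> r i"
      using \<open>r \<le> r'\<close> by blast
    moreover from this have "0 < m * (r' - r)" using that by simp
    ultimately show ?thesis by linarith
  qed
  have cont: "continuous_on {0..} (\<lambda>r. \<sigma> r i)" for i
    unfolding continuous_on_def
  proof
    fix r :: real assume r: "r \<in> {0..}"
    show "((\<lambda>r. \<sigma> r i) \<longlongrightarrow> \<sigma> r i) (at r within {0..})"
    proof (cases "r = 0")
      case True
      \<comment> \<open>Continuity at zero comes from squeezing between \<open>0\<close> and
        \<open>\<phi>\<close>.\<close>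
      have phi0: "\<phi> 0 = 0" and "continuous_on {0..} \<phi>" using phi_K by (auto simp: class_K_def)
      then have "(\<phi> \<longlongrightarrow> \<phi> 0) (at 0 within {0..})" unfolding continuous_on_def by blast
      then have "(\<phi> \<longlongrightarrow> 0) (at 0 within {0..})" by (simp only: phi0)
      then have "((\<lambda>r. \<sigma> r i) \<longlongrightarrow> 0) (at 0 within {0..})"
        by (rule tendsto_sandwich[OF _ _ tendsto_const, rotated 2])
          (auto simp: eventually_at_filter sigma_nonneg sigma_le)
      then show ?thesis by (simp add: True sigma_zero)
    next
      case False
      then have r0: "0 < r" using r by simp
      \<comment> \<open>The interval from \<open>r / 2\<close> to \<open>2 * r\<close> is a
        neighbourhood of \<open>r\<close> that stays away from zero.\<close>
      obtain M where M: "0 < M" "\<And>x y. r / 2 \<le> x \<Longrightarrow> x \<le> y \<Longrightarrow> y \<le> 2 * r \<Longrightarrow>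
          \<sigma> y i - \<sigma> x i \<le> M * (y - x)"
        using incr[of "r / 2" "2 * r"] r0 by force
      have "M-lipschitz_on {r/2..2*r} (\<lambda>r. \<sigma> r i)"
      proof (rule lipschitz_on_leI)
        fix x y assume "x \<in> {r/2..2*r}" "y \<in> {r/2..2*r}" "x \<le> y"
        then show "dist (\<sigma> x i) (\<sigma> y i) \<le> M * dist x y"
          using M(2)[of x y] sigma_mono[of x y i] r0 by (simp add: dist_real_def)
      qed (use M in simp)
      then have "continuous_on {r/2<..<2*r} (\<lambda>r. \<sigma> r i)"
        by (rule continuous_on_subset[OF lipschitz_on_continuous_on]) auto
      then have "isCont (\<lambda>r. \<sigma> r i) r"
        using r0 by (subst (asm) continuous_on_eq_continuous_at) auto
      then show ?thesis unfolding isCont_def by (rule tendsto_within_subset) simp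
    qed
  qed
  have unb: "\<not> bdd_above ((\<lambda>r. \<sigma> r i) ` {0..})" for i
  proof
    assume "bdd_above ((\<lambda>r. \<sigma> r i) ` {0..})"
    then obtain B where "\<And>r. 0 \<le> r \<Longrightarrow> \<sigma> r i \<le> B" by (auto simp: bdd_above_def)
    from this[of "max 0 B + 1"] show False using sigma_ge[of "max 0 B + 1" i] by simp
  qed
  have Kinf: "(\<lambda>r. \<sigma> r i) \<in> class_Kinf" for i
    using cont unb strict
    by (auto simp: class_Kinf_def class_K_def sigma_nonneg sigma_zero strict_mono_on_def)
  have id_Kinf: "(\<lambda>r. r) \<in> class_Kinf"
  proof -
    have "\<not> bdd_above {0::real..}"
    proof
      assume "bdd_above {0::real..}"
      then obtain B :: real where "\<And>r. 0 \<le> r \<Longrightarrow> r \<le> B" by (auto simp: bdd_above_def)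
      from this[of "\<bar>B\<bar> + 1"] show False by simp
    qed
    then show ?thesis by (auto simp: class_Kinf_def class_K_def strict_mono_on_def)
  qed
  have bilip: "\<exists>c C. 0 < c \<and> c \<le> C \<and>
      (\<forall>i. \<forall>y\<^sub>1\<in>{a..b}. \<forall>y\<^sub>2\<in>{a..b}.
        c * \<bar>y\<^sub>1 - y\<^sub>2\<bar> \<le> \<bar>inv_pos (\<lambda>r. \<sigma> r i) y\<^sub>1 - inv_pos (\<lambda>r. \<sigma> r i) y\<^sub>2\<bar> \<and>
        \<bar>inv_pos (\<lambda>r. \<sigma> r i) y\<^sub>1 - inv_pos (\<lambda>r. \<sigma> r i) y\<^sub>2\<bar> \<le> C * \<bar>y\<^sub>1 - y\<^sub>2\<bar>)"
    if ab: "0 < a" "a \<le> b" for a b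
  proof -
    \<comment> \<open>For every \<open>i\<close>, the preimages of \<open>{a..b}\<close> lie in
      \<open>{\<alpha>..b}\<close>: the bound \<open>\<sigma> \<le> \<phi>\<close> gives the left
      end, and \<open>\<sigma> \<ge> id\<close> the right end.\<close>
    define \<alpha> where "\<alpha> = inv_pos \<phi> a"
    have phi\<alpha>: "\<phi> \<alpha> = a" and "0 \<le> \<alpha>"
      unfolding \<alpha>_def using ab by (simp_all add: inv_pos_right inv_pos_nonneg phi)
    then have \<alpha>: "0 < \<alpha>" "\<alpha> \<le> b"
      using ab phi_K le_phi[of \<alpha>] by (auto simp: class_K_def less_le)
    obtain m M where m: "0 < m" "0 < M" and inc: "\<And>i r r'. \<alpha> \<le> r \<Longrightarrow> r \<le> r' \<Longrightarrow> r' \<le> b \<Longrightarrow>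
        m * (r' - r) \<le> \<sigma> r' i - \<sigma> r i \<and> \<sigma> r' i - \<sigma> r i \<le> M * (r' - r)"
      using incr[OF \<alpha>] by blast
    \<comment> \<open>Enlarging \<open>M\<close> to \<open>max m M\<close> guarantees that the
      reciprocal constants are ordered as required.\<close>
    have inc': "m * (r' - r) \<le> \<sigma> r' i - \<sigma> r i \<and> \<sigma> r' i - \<sigma> r i \<le> max m M * (r' - r)"
      if "\<alpha> \<le> r" "r \<le> r'" "r' \<le> b" for i r r'
      using inc[OF that, of i] mult_right_mono[of M "max m M" "r' - r"] that by simp
    have range: "0 \<le> y \<and> inv_pos (\<lambda>r. \<sigma> r i) y \<in> {\<alpha>..b}" if "y \<in> {a..b}" for y i
    proof -
      let ?x = "inv_pos (\<lambda>r. \<sigma> r i) y"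
      have y: "0 \<le> y" using that ab by simp
      then have x: "0 \<le> ?x" "\<sigma> ?x i = y" using inv_pos_nonneg[OF Kinf] inv_pos_right[OF Kinf] by auto
      have "\<phi> \<alpha> \<le> \<phi> ?x" using sigma_le[OF x(1), of i] x(2) phi\<alpha> that by simp
      then have "\<alpha> \<le> ?x" using class_K_le_iff[OF phi_K] \<alpha> x by simp
      moreover have "?x \<le> b" using sigma_ge[OF x(1), of i] x(2) that by simp
      ultimately show ?thesis using y by simp
    qed
    show ?thesis
    proof (rule exI[of _ "1 / max m M"], rule exI[of _ "1 / m"], intro conjI allI ballI)
      fix i y\<^sub>1 y\<^sub>2 assume "y\<^sub>1 \<in> {a..b}" "y\<^sub>2 \<in> {a..b}"
      then have y: "0 \<le> y\<^sub>1" "inv_pos (\<lambda>r. \<sigma> r i) y\<^sub>1 \<in> {\<alpha>..b}"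
          "0 \<le> y\<^sub>2" "inv_pos (\<lambda>r. \<sigma> r i) y\<^sub>2 \<in> {\<alpha>..b}"
        using range by blast+
      show "1 / max m M * \<bar>y\<^sub>1 - y\<^sub>2\<bar> \<le> \<bar>inv_pos (\<lambda>r. \<sigma> r i) y\<^sub>1 - inv_pos (\<lambda>r. \<sigma> r i) y\<^sub>2\<bar>"
        by (rule inv_pos_bilipschitz(1)[OF Kinf m(1) max.cobounded1 inc' y])
      show "\<bar>inv_pos (\<lambda>r. \<sigma> r i) y\<^sub>1 - inv_pos (\<lambda>r. \<sigma> r i) y\<^sub>2\<bar> \<le> 1 / m * \<bar>y\<^sub>1 - y\<^sub>2\<bar>"
        by (rule inv_pos_bilipschitz(2)[OF Kinf m(1) max.cobounded1 inc' y])
    qed (use m in \<open>simp_all add: frac_le\<close>)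
  qed
  show ?thesis
    unfolding path_of_decay_def
  proof (intro conjI)
    show "\<forall>r\<ge>0. \<Gamma> (\<sigma> r) \<le> \<sigma> r"
    proof (intro allI impI le_funI)
      show "\<Gamma> (\<sigma> r) i \<le> \<sigma> r i" if "0 \<le> r" for r i
        using sigma_eq[OF that, of i] by linarith
    qed
    show "\<exists>\<sigma>min\<in>class_Kinf. \<exists>\<sigma>max\<in>class_Kinf. \<forall>i. \<forall>r\<ge>0. \<sigma>min r \<le> \<sigma> r i \<and> \<sigma> r i \<le> \<sigma>max r"
      by (rule bexI[OF bexI[OF _ phi] id_Kinf]) (simp add: sigma_ge sigma_le)
  qed (intro allI impI sigma_linf_plus Kinf bilip; simp)+
qed

end

section \<open>Order contraction and convergence from above\<close>

locale contracting_gain_operator = gain_operator +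
  assumes contraction: "\<And>R\<^sub>1 R\<^sub>2. 0 < R\<^sub>1 \<Longrightarrow> R\<^sub>1 < R\<^sub>2 \<Longrightarrow>
      \<exists>K. 0 < K \<and> K < 1 \<and>
        (\<forall>s\<^sub>1 s\<^sub>2. const_seq R\<^sub>1 \<le> s\<^sub>1 \<and> s\<^sub>1 \<le> s\<^sub>2 \<and> s\<^sub>2 \<le> const_seq R\<^sub>2 \<longrightarrow>
          linf_norm (\<Gamma> (\<Gamma> s\<^sub>2) - \<Gamma> (\<Gamma> s\<^sub>1)) \<le> K * linf_norm (s\<^sub>2 - s\<^sub>1))"
begin

text \<open>The inner truncation shrinks increments by \<open>Gamma_max_diff_le\<close>, and the
  outer maximum is nonexpansive. \<open>K\<close> depends only on the order interval and not on the
  level \<open>r\<close>; \<open>d\<close> replaces the norm by any upper bound on the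
  increments.\<close>

lemma Gamma_r_contraction:
  assumes "0 < R\<^sub>1" "R\<^sub>1 < R\<^sub>2"
  obtains K where "0 < K" "K < 1"
    "\<And>r s t d i. 0 \<le> r \<Longrightarrow> (\<And>j. R\<^sub>1 \<le> s j) \<Longrightarrow> (\<And>j. s j \<le> t j) \<Longrightarrow> (\<And>j. t j \<le> R\<^sub>2) \<Longrightarrow>
       (\<And>j. t j - s j \<le> d) \<Longrightarrow>
       Gamma_r \<Gamma> r (Gamma_r \<Gamma> r t) i - Gamma_r \<Gamma> r (Gamma_r \<Gamma> r s) i \<le> K * d"
proof -
  obtain K where K: "0 < K" "K < 1" and contr:
    "\<And>s t. const_seq R\<^sub>1 \<le> s \<Longrightarrow> s \<le> t \<Longrightarrow> t \<le> const_seq R\<^sub>2 \<Longrightarrow>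
       linf_norm (\<Gamma> (\<Gamma> t) - \<Gamma> (\<Gamma> s)) \<le> K * linf_norm (t - s)"
    using contraction[OF assms] by blast
  have "Gamma_r \<Gamma> r (Gamma_r \<Gamma> r t) i - Gamma_r \<Gamma> r (Gamma_r \<Gamma> r s) i \<le> K * d"
    if r: "0 \<le> r" and s: "\<And>j. R\<^sub>1 \<le> s j" and st: "\<And>j. s j \<le> t j" and t: "\<And>j. t j \<le> R\<^sub>2"
      and d: "\<And>j. t j - s j \<le> d" for r s t d i
  proof -
    have s0: "0 \<le> s j" for j using s[of j] assms by simp
    have t0: "0 \<le> t j" for j using s0[of j] st[of j] by simp
    have "s j \<le> R\<^sub>2" for j using st[of j] t[of j] by simp
    then have "s \<in> linf_plus" "t \<in> linf_plus"
      using s0 t0 t linf_plusI[where M = "R\<^sub>2"] by blast+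
    then have "\<Gamma> (\<Gamma> t) - \<Gamma> (\<Gamma> s) \<in> linf"
      using Gamma_linf_plus by (intro linf_diff) (auto simp: linf_plus_def)
    then have "\<Gamma> (\<Gamma> t) i - \<Gamma> (\<Gamma> s) i \<le> linf_norm (\<Gamma> (\<Gamma> t) - \<Gamma> (\<Gamma> s))"
      using abs_le_linf_norm[of _ i] by fastforce
    also have "\<dots> \<le> K * linf_norm (t - s)" using s st t by (intro contr) (auto simp: le_fun_def)
    also have "\<dots> \<le> K * d" using K st d by (intro mult_left_mono linf_norm_le) auto
    finally have *: "\<Gamma> (\<Gamma> t) i - \<Gamma> (\<Gamma> s) i \<le> K * d" .
    have G: "Gamma_r \<Gamma> r u = (\<lambda>j. max r (\<Gamma> u j))" for u by (rule ext) (rule Gamma_r_apply)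
    \<comment> \<open>Nonnegativity of the bound covers the case where the outer truncation cancels
      the difference.\<close>
    have "0 \<le> d" using st[of 0] d[of 0] by simp
    then have "0 \<le> K * d" using K by simp
    moreover have "\<Gamma> (\<lambda>j. max r (\<Gamma> t j)) i - \<Gamma> (\<lambda>j. max r (\<Gamma> s j)) i \<le> \<Gamma> (\<Gamma> t) i - \<Gamma> (\<Gamma> s) i"
      using r s0 st by (intro Gamma_max_diff_le Gamma_nonneg Gamma_mono)
    ultimately show ?thesis using * unfolding G by linarith
  qed
  with K show ?thesis using that by blast
qed

lemma Gamma_r_pow_even_le:
  assumes "0 < r"
  shows "\<exists>K. 0 < K \<and> K < 1 \<and>
    (\<forall>n i. (Gamma_r \<Gamma> r ^^ (2 * n)) (const_seq (\<phi> r)) i \<le> \<sigma> r i + K ^ n * \<phi> r)"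
proof -
  have r: "0 \<le> r" "r \<le> \<phi> r" using assms le_phi by auto
  \<comment> \<open>The upper end \<open>2 * \<phi> r\<close> leaves room for
    \<open>\<sigma> r\<close> plus the error \<open>K ^ n * \<phi> r\<close>, both at most
    \<open>\<phi> r\<close>, and makes the interval nondegenerate.\<close>
  obtain K where K: "0 < K" "K < 1" and contr:
    "\<And>q s t d i. 0 \<le> q \<Longrightarrow> (\<And>j. r \<le> s j) \<Longrightarrow> (\<And>j. s j \<le> t j) \<Longrightarrow> (\<And>j. t j \<le> 2 * \<phi> r) \<Longrightarrow>
       (\<And>j. t j - s j \<le> d) \<Longrightarrow>
       Gamma_r \<Gamma> q (Gamma_r \<Gamma> q t) i - Gamma_r \<Gamma> q (Gamma_r \<Gamma> q s) i \<le> K * d"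
    by (rule Gamma_r_contraction[of r "2 * \<phi> r"]) (use r assms in auto)
  let ?t = "\<lambda>n. (Gamma_r \<Gamma> r ^^ (2 * n)) (const_seq (\<phi> r))"
  have "\<sigma> r i \<le> ?t n i \<and> ?t n i \<le> \<sigma> r i + K ^ n * \<phi> r" for n i
  proof (induction n arbitrary: i)
    case 0
    then show ?case using sigma_le[of r i] sigma_nonneg[of r i] r by simp
  next
    case (Suc n)
    have le: "\<sigma> r j \<le> ?t n j" and diff: "?t n j - \<sigma> r j \<le> K ^ n * \<phi> r" for j
      using Suc[of j] by auto
    have "K ^ n * \<phi> r \<le> \<phi> r"
      using K r by (intro mult_left_le_one_le) (auto simp: power_le_one)
    then have ub: "?t n j \<le> 2 * \<phi> r" for j using diff[of j] sigma_le[of r j] r by linarith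
    have fix2: "Gamma_r \<Gamma> r (Gamma_r \<Gamma> r (\<sigma> r)) = \<sigma> r" using sigma_fixed r by simp
    have le1: "\<sigma> r j \<le> Gamma_r \<Gamma> r (?t n) j" for j
      using sigma_le_Gamma_r[OF r(1) le] .
    have "\<sigma> r i \<le> Gamma_r \<Gamma> r (Gamma_r \<Gamma> r (?t n)) i"
      using sigma_le_Gamma_r[OF r(1) le1] .
    moreover have "Gamma_r \<Gamma> r (Gamma_r \<Gamma> r (?t n)) i - Gamma_r \<Gamma> r (Gamma_r \<Gamma> r (\<sigma> r)) i
        \<le> K * (K ^ n * \<phi> r)"
      using r le ub diff by (intro contr sigma_ge)
    ultimately show ?case unfolding fix2 by (simp add: mult.assoc)
  qed
  with K show ?thesis by blast
qed

text \<open>Monotonicity keeps the iterates from \<open>\<phi> r\<close> above the fixed point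
  \<open>\<sigma> r\<close>, while the even ones approach it geometrically. The contraction needs a
  positive lower end, so \<open>r = 0\<close> is separate; there both limits vanish.\<close>

lemma sigma_sub_eq_sigma_sup:
  assumes "0 \<le> r"
  shows "\<sigma> r = sigma_sup \<Gamma> \<phi> r"
proof (cases "r = 0")
  case True
  have phi0: "\<phi> 0 = 0" using phi_K by (simp add: class_K_def)
  have "(Gamma_r \<Gamma> 0 ^^ n) (const_seq 0) = const_seq 0" for n
    by (induction n) (auto simp: Gamma_r_def Gamma_zero)
  then show ?thesis by (auto simp: sigma_sup_def True phi0 sigma_zero)
next
  case False
  let ?t = "\<lambda>n. (Gamma_r \<Gamma> r ^^ n) (const_seq (\<phi> r))"
  have lower: "\<sigma> r i \<le> ?t n i" for n i
  proof (induction n arbitrary: i)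
    case 0
    then show ?case using sigma_le assms by simp
  next
    case (Suc n)
    then show ?case
      using sigma_le_Gamma_r[OF assms Suc] by simp
  qed
  obtain K where K: "0 < K" "K < 1" and upper: "\<And>n i. ?t (2 * n) i \<le> \<sigma> r i + K ^ n * \<phi> r"
    using Gamma_r_pow_even_le[of r] False assms by auto
  show ?thesis
  proof
    fix i
    have bdd: "bdd_below (range (\<lambda>n. ?t n i))" using lower by (auto intro: bdd_belowI[of _ "\<sigma> r i"])
    have "(\<lambda>n. \<sigma> r i + K ^ n * \<phi> r) \<longlonglongrightarrow> \<sigma> r i + 0 * \<phi> r"
      using K by (intro tendsto_intros LIMSEQ_power_zero) auto
    moreover have "sigma_sup \<Gamma> \<phi> r i \<le> \<sigma> r i + K ^ n * \<phi> r" for n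
      unfolding sigma_sup_def using cINF_lower[OF bdd, of "2 * n"] upper order.trans by blast
    ultimately have "sigma_sup \<Gamma> \<phi> r i \<le> \<sigma> r i" using LIMSEQ_le_const by fastforce
    moreover have "\<sigma> r i \<le> sigma_sup \<Gamma> \<phi> r i"
      unfolding sigma_sup_def using lower by (intro cINF_greatest) auto
    ultimately show "\<sigma> r i = sigma_sup \<Gamma> \<phi> r i" by simp
  qed
qed

text \<open>Let \<open>d\<close> be the supremum of the increments and let \<open>?G'\<close> be the
  operator at level \<open>r'\<close>. Its square contracts the distance from
  \<open>\<sigma> r\<close> to the fixed point \<open>\<sigma> r'\<close>, and moves
  \<open>\<sigma> r\<close> itself by at most a multiple of \<open>r' - r\<close>. Hence
  \<open>d \<le> K * d + m * (r' - r)\<close>, which is solved for \<open>d\<close>.\<close>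

lemma sigma_lipschitz:
  assumes card: "\<And>i. card (I i) \<le> N" and ab: "0 < a" "a \<le> b"
    and L: "0 < L" "\<And>i j x y. j \<in> I i \<Longrightarrow> x \<in> {a..\<phi> b} \<Longrightarrow> y \<in> {a..\<phi> b} \<Longrightarrow>
      \<bar>\<gamma> i j x - \<gamma> i j y\<bar> \<le> L * \<bar>x - y\<bar>"
  obtains M where "0 < M"
    "\<And>i r r'. a \<le> r \<Longrightarrow> r \<le> r' \<Longrightarrow> r' \<le> b \<Longrightarrow> \<sigma> r' i - \<sigma> r i \<le> M * (r' - r)"
proof -
  have b: "b \<le> \<phi> b" using le_phi[of b] ab by simp
  \<comment> \<open>Adding 1 keeps the interval nondegenerate even if
    \<open>\<phi> b = a\<close>.\<close>
  obtain K where K: "0 < K" "K < 1" and contr: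
    "\<And>r s t d i. 0 \<le> r \<Longrightarrow> (\<And>j. a \<le> s j) \<Longrightarrow> (\<And>j. s j \<le> t j) \<Longrightarrow> (\<And>j. t j \<le> \<phi> b + 1) \<Longrightarrow>
       (\<And>j. t j - s j \<le> d) \<Longrightarrow>
       Gamma_r \<Gamma> r (Gamma_r \<Gamma> r t) i - Gamma_r \<Gamma> r (Gamma_r \<Gamma> r s) i \<le> K * d"
    by (rule Gamma_r_contraction[of a "\<phi> b + 1"]) (use ab b in auto)
  \<comment> \<open>The 1 accounts for raising the outer truncation level, and \<open>N * L\<close>
    for raising the inner one, seen through at most \<open>N\<close> gains with Lipschitz constant
    \<open>L\<close>.\<close>
  define m where "m = max 1 (real N * L)"
  have "\<sigma> r' i - \<sigma> r i \<le> m / (1 - K) * (r' - r)" if r: "a \<le> r" "r \<le> r'" "r' \<le> b" for i r r'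
  proof -
    let ?G = "Gamma_r \<Gamma> r" and ?G' = "Gamma_r \<Gamma> r'"
    have r0: "0 \<le> r" "0 \<le> r'" using r ab by auto
    have phib: "\<phi> r' \<le> \<phi> b" using class_K_mono[OF phi_K] r r0 by simp
    have up: "\<sigma> r' j \<le> \<phi> b" for j using sigma_le[of r' j] phib r0 by simp
    then have up': "\<sigma> r' j \<le> \<phi> b + 1" for j by (rule add_increasing2[rotated]) simp
    have lo: "a \<le> \<sigma> r j" for j using sigma_ge[of r j] r r0 by simp
    have mono: "\<sigma> r j \<le> \<sigma> r' j" for j using sigma_mono r r0 by simp
    have Gamma_le: "\<Gamma> (\<sigma> r) j \<le> \<Gamma> (\<sigma> r') j" for j
      using r0 mono by (intro Gamma_mono sigma_nonneg)
    \<comment> \<open>\<open>\<sigma> r\<close> is fixed at level \<open>r\<close>, so only the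
      change of level counts. The result stays below \<open>\<sigma> r'\<close>, hence in the range
      where \<open>L\<close> is valid.\<close>
    have pert1: "\<sigma> r j \<le> ?G' (\<sigma> r) j" "?G' (\<sigma> r) j \<le> \<sigma> r' j" "?G' (\<sigma> r) j - \<sigma> r j \<le> r' - r" for j
      using sigma_eq[of r j] sigma_eq[of r' j] r r0 Gamma_le[of j]
      by (auto simp: Gamma_r_apply)
    have nonneg': "0 \<le> ?G' (\<sigma> r) j" for j using pert1(1)[of j] sigma_nonneg[of r j] r0 by simp
    have "\<Gamma> (?G' (\<sigma> r)) j - \<Gamma> (\<sigma> r) j \<le> m * (r' - r)" for j
    proof -
      have "\<Gamma> (?G' (\<sigma> r)) j - \<Gamma> (\<sigma> r) j
          = (\<Sum>k\<in>I j. \<gamma> j k (?G' (\<sigma> r) k) - \<gamma> j k (\<sigma> r k))"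
        using nonneg' r0 by (simp add: Gamma_eq sigma_nonneg sum_subtractf)
      also have "\<dots> \<le> (\<Sum>k\<in>I j. L * (r' - r))"
      proof (rule sum_mono)
        fix k assume "k \<in> I j"
        then have "\<bar>\<gamma> j k (?G' (\<sigma> r) k) - \<gamma> j k (\<sigma> r k)\<bar> \<le> L * \<bar>?G' (\<sigma> r) k - \<sigma> r k\<bar>"
          using pert1[of k] lo[of k] up[of k] by (intro L) auto
        also have "\<dots> \<le> L * (r' - r)" using pert1[of k] L(1) by (intro mult_left_mono) auto
        finally show "\<gamma> j k (?G' (\<sigma> r) k) - \<gamma> j k (\<sigma> r k) \<le> L * (r' - r)" by simp
      qed
      also have "\<dots> = real (card (I j)) * L * (r' - r)" by simp
      also have "\<dots> \<le> m * (r' - r)"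
      proof (rule mult_right_mono)
        have "real (card (I j)) * L \<le> real N * L" using card[of j] L(1) by (simp add: mult_right_mono)
        then show "real (card (I j)) * L \<le> m" by (simp add: m_def)
      qed (use r in simp)
      finally show ?thesis .
    qed
    moreover have "r' - r \<le> m * (r' - r)" using r by (simp add: m_def mult_le_cancel_right1)
    ultimately have pert2: "?G' (?G' (\<sigma> r)) j - \<sigma> r j \<le> m * (r' - r)" for j
      using sigma_eq[of r j] r0 by (smt (verit) Gamma_r_apply)
    define d where "d = (SUP j. \<sigma> r' j - \<sigma> r j)"
    have "\<sigma> r' j - \<sigma> r j \<le> \<phi> b" for j using up[of j] lo[of j] ab by simp
    then have bdd: "bdd_above (range (\<lambda>j. \<sigma> r' j - \<sigma> r j))"
      by (auto intro: bdd_aboveI[of _ "\<phi> b"])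
    have d: "\<sigma> r' j - \<sigma> r j \<le> d" for j unfolding d_def by (rule cSUP_upper[OF _ bdd]) simp
    have "\<sigma> r' j - \<sigma> r j \<le> K * d + m * (r' - r)" for j
    proof -
      have "?G' (?G' (\<sigma> r')) j - ?G' (?G' (\<sigma> r)) j \<le> K * d"
        using lo mono d up' r0 by (intro contr)
      then show ?thesis using pert2[of j] r0 by (simp add: sigma_fixed)
    qed
    then have "d \<le> K * d + m * (r' - r)" unfolding d_def[symmetric]
      by (subst d_def) (rule cSUP_least; simp)
    then have "d \<le> m / (1 - K) * (r' - r)" using K by (simp add: field_simps)
    then show ?thesis using d[of i] by simp
  qed
  moreover have "0 < m / (1 - K)" using K by (simp add: m_def)
  ultimately show ?thesis using that by blast
qed

end

section \<open>Both increment bounds on a given compact interval\<close>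

theorem theorem5p16:
  fixes I :: "nat \<Rightarrow> nat set"
    and \<gamma> :: "nat \<Rightarrow> nat \<Rightarrow> real \<Rightarrow> real"
    and \<Gamma> :: "(nat \<Rightarrow> real) \<Rightarrow> nat \<Rightarrow> real"
    and \<phi> :: "real \<Rightarrow> real"
  assumes gains: "gain_family I \<gamma>"
    and Gamma: "\<Gamma> = sum_gain \<gamma>"
    and well_defined: "\<Gamma> ` linf_plus \<subseteq> linf_plus"
    and continuous: "norm_continuous \<Gamma>"
    and phi: "\<phi> \<in> class_Kinf"
    and MBI: "oplus_MBI \<Gamma> \<phi>"
    and A: "pointwise_equicontinuous \<gamma>"
    and B: "\<exists>\<omega>\<in>class_Kinf. (\<forall>r>0. \<omega> r < r) \<and> UGAS (\<lambda>s i. inv_pos \<omega> (\<Gamma> s i))"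
    and C: "\<And>a b. 0 < a \<Longrightarrow> a \<le> b \<Longrightarrow>
      \<exists>c>0. \<forall>i. \<forall>j\<in>I i. \<forall>r\<^sub>1\<in>{a..b}. \<forall>r\<^sub>2\<in>{a..b}.
        c * \<bar>r\<^sub>1 - r\<^sub>2\<bar> \<le> \<bar>\<gamma> i j r\<^sub>1 - \<gamma> i j r\<^sub>2\<bar>"
    and contraction: "\<And>R\<^sub>1 R\<^sub>2. 0 < R\<^sub>1 \<Longrightarrow> R\<^sub>1 < R\<^sub>2 \<Longrightarrow>
      \<exists>K. 0 < K \<and> K < 1 \<and>
        (\<forall>s\<^sub>1 s\<^sub>2. const_seq R\<^sub>1 \<le> s\<^sub>1 \<and> s\<^sub>1 \<le> s\<^sub>2 \<and> s\<^sub>2 \<le> const_seq R\<^sub>2 \<longrightarrow>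
          linf_norm (\<Gamma> (\<Gamma> s\<^sub>2) - \<Gamma> (\<Gamma> s\<^sub>1)) \<le> K * linf_norm (s\<^sub>2 - s\<^sub>1))"
    and card_bounded: "\<exists>N. \<forall>i. card (I i) \<le> N"
    and Lipschitz: "\<And>a b. 0 < a \<Longrightarrow> a \<le> b \<Longrightarrow>
      \<exists>C>0. \<forall>i. \<forall>j\<in>I i. \<forall>r\<^sub>1\<in>{a..b}. \<forall>r\<^sub>2\<in>{a..b}.
        \<bar>\<gamma> i j r\<^sub>1 - \<gamma> i j r\<^sub>2\<bar> \<le> C * \<bar>r\<^sub>1 - r\<^sub>2\<bar>"
  shows "(\<forall>r\<ge>0. \<forall>i. bdd_above (range (\<lambda>k::nat. (augmented \<Gamma> ^^ k) (const_seq r) i))) \<and>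
         (\<forall>r\<ge>0. sigma_sub \<Gamma> r = sigma_sup \<Gamma> \<phi> r) \<and>
         path_of_decay \<Gamma> (sigma_sub \<Gamma>)"
proof -
  interpret contracting_gain_operator I \<gamma> \<phi>
    using gains well_defined phi MBI contraction unfolding Gamma by unfold_locales auto
  obtain \<omega> where \<omega>: "\<omega> \<in> class_Kinf" "\<And>r. 0 < r \<Longrightarrow> \<omega> r < r"
    and UGAS: "UGAS (\<lambda>s i. inv_pos \<omega> (sum_gain \<gamma> s i))"
    using B unfolding Gamma by blast
  obtain N where N: "\<And>i. card (I i) \<le> N" using card_bounded by blast
  have "path_of_decay (sum_gain \<gamma>) (sigma_sub (sum_gain \<gamma>))"
  proof (rule path_of_decayI)
    fix a b :: real assume ab: "0 < a" "a \<le> b"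
    then have phib: "a \<le> \<phi> b" "0 < \<phi> b" using le_phi[of b] by auto
    obtain c where c: "0 < c" "\<And>i j x y. j \<in> I i \<Longrightarrow> x \<in> {a..\<phi> b} \<Longrightarrow> y \<in> {a..\<phi> b} \<Longrightarrow>
        c * \<bar>x - y\<bar> \<le> \<bar>\<gamma> i j x - \<gamma> i j y\<bar>"
      using C[OF ab(1) phib(1)] by blast
    \<comment> \<open>The constant is capped at 1 because the path argument uses that its powers are
      at most 1.\<close>
    have c': "min c 1 * \<bar>x - y\<bar> \<le> \<bar>\<gamma> i j x - \<gamma> i j y\<bar>"
      if "j \<in> I i" "x \<in> {a..\<phi> b}" "y \<in> {a..\<phi> b}" for i j x y
      using c(2)[OF that] mult_right_mono[of "min c 1" c "\<bar>x - y\<bar>"] by simp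
    obtain L where L: "0 < L" "\<And>i j x y. j \<in> I i \<Longrightarrow> x \<in> {a..\<phi> b} \<Longrightarrow> y \<in> {a..\<phi> b} \<Longrightarrow>
        \<bar>\<gamma> i j x - \<gamma> i j y\<bar> \<le> L * \<bar>x - y\<bar>"
      using Lipschitz[OF ab(1) phib(1)] by blast
    obtain M where M: "0 < M" "\<And>i r r'. a \<le> r \<Longrightarrow> r \<le> r' \<Longrightarrow> r' \<le> b \<Longrightarrow>
        sigma_sub (sum_gain \<gamma>) r' i - sigma_sub (sum_gain \<gamma>) r i \<le> M * (r' - r)"
      using sigma_lipschitz[OF N ab L] by blast
    \<comment> \<open>This path length depends only on \<open>a\<close> and \<open>b\<close>, so the
      constant \<open>min c 1 ^ n\<close> is uniform in \<open>i\<close>.\<close>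
    obtain n where n: "\<And>i. (sum_gain \<gamma> ^^ n) (const_seq (\<phi> b)) i < a"
      using Gamma_pow_const_small[OF \<omega> UGAS phib(2) ab(1)] by blast
    show "\<exists>m M. 0 < m \<and> 0 < M \<and> (\<forall>i r r'. a \<le> r \<longrightarrow> r \<le> r' \<longrightarrow> r' \<le> b \<longrightarrow>
        m * (r' - r) \<le> sigma_sub (sum_gain \<gamma>) r' i - sigma_sub (sum_gain \<gamma>) r i \<and>
        sigma_sub (sum_gain \<gamma>) r' i - sigma_sub (sum_gain \<gamma>) r i \<le> M * (r' - r))"
      using M c(1) sigma_increment_ge[OF ab _ _ c' n]
      by (intro exI[of _ "min c 1 ^ n"] exI[of _ M]) auto
  qed
  then show ?thesis
    unfolding Gamma by (intro conjI allI impI augmented_bdd sigma_sub_eq_sigma_sup)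
qed

end
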